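(* Let $T$ be a topological space which has a finite 2-dimensional triangulation in which every vertex is a vertex of a 2-simplex and every edge is an edge of a 2-simplex. Then there exists a finite metric space $(X,d)$ whose string space $|X,d|$ is homeomorphic to $T$.
   Context: A triangulation of a topological space is a homeomorphism from the space to the geometric realization of a simplicial complex; it is finite and 2-dimensional if the complex is finite and of dimension 2. Vertices and edges are its 0-simplexes and 1-simplexes. Strings in a metric space $(X,d)$ are certain finite non-empty subsets of $X$, defined as follows. (i) For $n\geq 3$, a string of length $n$ is an $n$-element set $S\subset X$ whose elements can be ordered $x_1,x_2,\ldots,x_n$ so that $d(x_1,x_2)+d(x_2,x_3)+\cdots+d(x_{n-1},x_n)=d(x_1,x_n)$. (ii) A 2-element subset of $X$ is a string (of length 2) if it is contained in a string of length 3. (iii) A 1-element subset $\{x\}\subset X$ is a string (of length 1) if $x$ belongs to a string of length 3. Every non-empty subset of a string is a string, so the strings in $(X,d)$ form an abstract simplicial complex, in which a string of length $n$ is a simplex of dimension $n-1$ whose vertices are the elements of the string. The string space $|X,d|$ is the geometric realization of this abstract simplicial complex (it is empty if there are no strings). *)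

theory Defs
  imports "HOL-Analysis.Analysis"
begin

section \<open>Abstract simplicial complexes\<close>

definition abstract_simplicial_complex :: "'v set set \<Rightarrow> bool" where
  "abstract_simplicial_complex K \<longleftrightarrow>
     (\<forall>s\<in>K. finite s \<and> s \<noteq> {}) \<and> (\<forall>s\<in>K. \<forall>t. t \<subseteq> s \<and> t \<noteq> {} \<longrightarrow> t \<in> K)"

definition simplexes :: "nat \<Rightarrow> 'v set set \<Rightarrow> 'v set set" where
  "simplexes n K = {s \<in> K. card s = Suc n}"

definition complex_dimension :: "'v set set \<Rightarrow> nat \<Rightarrow> bool" where
  "complex_dimension K n \<longleftrightarrow> simplexes n K \<noteq> {} \<and> (\<forall>s\<in>K. card s \<le> Suc n)"


section \<open>Geometric realization\<close>

text \<open>Points are given by barycentric coordinates, indexed by the whole vertex type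
  and zero off the simplex. The topology on functions is the product topology.\<close>

definition geometric_simplex :: "'v set \<Rightarrow> ('v \<Rightarrow> real) set" where
  "geometric_simplex s =
     {a. (\<forall>v. 0 \<le> a v) \<and> (\<forall>v. v \<notin> s \<longrightarrow> a v = 0) \<and> (\<Sum>v\<in>s. a v) = 1}"

text \<open>The weak (coherent) topology: a set is open iff its trace on every closed simplex
  is open there.\<close>

definition geometric_realization :: "'v set set \<Rightarrow> ('v \<Rightarrow> real) topology" where
  "geometric_realization K = topology (\<lambda>U.
     U \<subseteq> (\<Union>s\<in>K. geometric_simplex s) \<and>
     (\<forall>s\<in>K. openin (top_of_set (geometric_simplex s)) (U \<inter> geometric_simplex s)))"

lemma openin_geometric_realization:
  "openin (geometric_realization K) U \<longleftrightarrow>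
     U \<subseteq> (\<Union>s\<in>K. geometric_simplex s) \<and>
     (\<forall>s\<in>K. openin (top_of_set (geometric_simplex s)) (U \<inter> geometric_simplex s))"
proof -
  have "istopology (\<lambda>U. U \<subseteq> (\<Union>s\<in>K. geometric_simplex s) \<and>
     (\<forall>s\<in>K. openin (top_of_set (geometric_simplex s)) (U \<inter> geometric_simplex s)))"
    (is "istopology ?P")
    unfolding istopology_def
  proof (intro conjI allI impI)
    fix S T assume S: "?P S" and T: "?P T"
    show "S \<inter> T \<subseteq> (\<Union>s\<in>K. geometric_simplex s)"
      using S by blast
    show "\<forall>s\<in>K. openin (top_of_set (geometric_simplex s)) (S \<inter> T \<inter> geometric_simplex s)"
    proof
      fix s assume "s \<in> K"
      then have "openin (top_of_set (geometric_simplex s)) (S \<inter> geometric_simplex s)"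
          "openin (top_of_set (geometric_simplex s)) (T \<inter> geometric_simplex s)"
        using S T by simp_all
      then have "openin (top_of_set (geometric_simplex s))
          ((S \<inter> geometric_simplex s) \<inter> (T \<inter> geometric_simplex s))"
        by (rule openin_Int)
      then show "openin (top_of_set (geometric_simplex s)) (S \<inter> T \<inter> geometric_simplex s)"
        by (simp only: Int_ac Int_left_absorb Int_absorb)
    qed
  next
    fix \<U> assume U: "\<forall>S\<in>\<U>. ?P S"
    show "\<Union>\<U> \<subseteq> (\<Union>s\<in>K. geometric_simplex s)"
      using U by blast
    show "\<forall>s\<in>K. openin (top_of_set (geometric_simplex s)) (\<Union>\<U> \<inter> geometric_simplex s)"
    proof
      fix s assume "s \<in> K"
      then have "\<forall>S\<in>\<U>. openin (top_of_set (geometric_simplex s)) (S \<inter> geometric_simplex s)"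
        using U \<open>s \<in> K\<close> by blast
      then have "openin (top_of_set (geometric_simplex s)) (\<Union>S\<in>\<U>. S \<inter> geometric_simplex s)"
        by (intro openin_Union) (erule imageE, erule ssubst, erule bspec)
      then show "openin (top_of_set (geometric_simplex s)) (\<Union>\<U> \<inter> geometric_simplex s)"
        by (simp only: Int_Union2)
    qed
  qed
  then show ?thesis
    unfolding geometric_realization_def by (simp only: topology_inverse')
qed

lemma topspace_geometric_realization:
  "topspace (geometric_realization K) = (\<Union>s\<in>K. geometric_simplex s)"
proof (rule subset_antisym)
  show "topspace (geometric_realization K) \<subseteq> (\<Union>s\<in>K. geometric_simplex s)"
    by (rule conjunct1[OF iffD1[OF openin_geometric_realization openin_topspace]])
  have "openin (geometric_realization K) (\<Union>s\<in>K. geometric_simplex s)"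
    unfolding openin_geometric_realization
  proof (intro conjI ballI subset_refl)
    fix s assume "s \<in> K"
    then have "(\<Union>s\<in>K. geometric_simplex s) \<inter> geometric_simplex s = geometric_simplex s"
      by blast
    then show "openin (top_of_set (geometric_simplex s))
        ((\<Union>s\<in>K. geometric_simplex s) \<inter> geometric_simplex s)"
      by (simp only: openin_subtopology_self)
  qed
  then show "(\<Union>s\<in>K. geometric_simplex s) \<subseteq> topspace (geometric_realization K)"
    by (rule openin_subset)
qed

definition is_triangulation ::
    "'t topology \<Rightarrow> 'v set set \<Rightarrow> ('t \<Rightarrow> 'v \<Rightarrow> real) \<Rightarrow> bool" where
  "is_triangulation T K h \<longleftrightarrow>
     abstract_simplicial_complex K \<and> homeomorphic_map T (geometric_realization K) h"


section \<open>Strings in a metric space\<close>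

definition long_string :: "'a set \<Rightarrow> ('a \<Rightarrow> 'a \<Rightarrow> real) \<Rightarrow> 'a set \<Rightarrow> bool" where
  "long_string X d S \<longleftrightarrow> S \<subseteq> X \<and>
     (\<exists>xs. distinct xs \<and> set xs = S \<and> length xs \<ge> 3 \<and>
        (\<Sum>i<length xs - 1. d (xs ! i) (xs ! Suc i)) = d (hd xs) (last xs))"

definition is_string :: "'a set \<Rightarrow> ('a \<Rightarrow> 'a \<Rightarrow> real) \<Rightarrow> 'a set \<Rightarrow> bool" where
  "is_string X d S \<longleftrightarrow>
     long_string X d S \<or>
     card S = 2 \<and> (\<exists>R. long_string X d R \<and> card R = 3 \<and> S \<subseteq> R) \<or>
     card S = 1 \<and> (\<exists>R. long_string X d R \<and> card R = 3 \<and> S \<subseteq> R)"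

definition string_space :: "'a set \<Rightarrow> ('a \<Rightarrow> 'a \<Rightarrow> real) \<Rightarrow> ('a \<Rightarrow> real) topology" where
  "string_space X d = geometric_realization {S. is_string X d S}"

end

theory Submission
  imports Defs
begin

text \<open>Take as points the simplexes of \<open>K\<close>, where two distinct points have distance 2 if they are a
  vertex and a triangle containing it, distance 1 if they are incident in another way, and distance
  3/2 otherwise. An equality \<open>d x y + d y z = d x z\<close> between distances in \<open>{1, 3/2, 2}\<close> can only read
  \<open>1 + 1 = 2\<close>, so the strings of length 3 are the full flags and there are no longer ones.
  Purity of \<open>K\<close> makes every chain of simplexes part of a full flag, hence the string complex is the
  barycentric subdivision of \<open>K\<close>. The simplexwise affine map from the subdivision to \<open>K\<close> is a continuous
  bijection between compact Hausdorff spaces, because a nonnegative function with finite support is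
  a nonnegative combination of indicators of a chain of nonempty sets in exactly one way.\<close>

section \<open>Topology of finite geometric realizations\<close>

lemma Hausdorff_space_euclidean_fun:
  "Hausdorff_space (euclidean :: ('v \<Rightarrow> real) topology)"
  by (metis Hausdorff_space_product_topology euclidean_product_topology
      Hausdorff_space_euclidean)

lemma closed_geometric_simplex: "closed (geometric_simplex s)"
proof -
  have "closed {a :: 'a \<Rightarrow> real. \<forall>v. 0 \<le> a v}"
    by (intro closed_Collect_all closed_Collect_le continuous_intros) simp
  moreover have "closed {a :: 'a \<Rightarrow> real. \<forall>v. v \<notin> s \<longrightarrow> a v = 0}"
    by (intro closed_Collect_all closed_Collect_imp closed_Collect_eq continuous_intros) auto
  moreover have "closed {a :: 'a \<Rightarrow> real. sum a s = 1}"
    by (intro closed_Collect_eq continuous_intros) simp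
  ultimately show ?thesis
    unfolding geometric_simplex_def by (intro closed_Collect_conj) simp_all
qed

lemma compact_geometric_simplex:
  assumes "finite s"
  shows "compact (geometric_simplex s)"
proof -
  \<comment> \<open>Coordinates are indexed by the whole vertex type, so the factors off
    \<open>s\<close> are the compact set \<open>{0}\<close> and Tychonoff's theorem applies.\<close>
  let ?B = "PiE UNIV (\<lambda>v. if v \<in> s then {0..1} else {0::real})"
  have "compactin (product_topology (\<lambda>_. euclidean) UNIV) ?B"
    unfolding compactin_PiE by auto
  then have "compact ?B"
    by (simp add: euclidean_product_topology)
  moreover have "geometric_simplex s \<subseteq> ?B"
  proof
    fix a assume "a \<in> geometric_simplex s"
    then have a: "\<And>v. 0 \<le> a v" "\<And>v. v \<notin> s \<Longrightarrow> a v = 0" "sum a s = 1"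
      by (auto simp: geometric_simplex_def)
    have "a v \<le> 1" if "v \<in> s" for v
      using member_le_sum[OF that, of a] a assms by simp
    with a show "a \<in> ?B"
      by auto
  qed
  ultimately have "compact (?B \<inter> geometric_simplex s)"
    by (intro compact_Int_closed closed_geometric_simplex)
  with \<open>geometric_simplex s \<subseteq> ?B\<close> show ?thesis
    by (simp add: Int_absorb1)
qed

text \<open>Relative to the polyhedron, the complement of a weakly open set is a finite union of
  closed sets, one in each simplex, and hence closed. The weak topology thus becomes a subspace
  topology, where compactness arguments are available.\<close>

lemma geometric_realization_finite:
  assumes "finite K"
  shows "geometric_realization K = top_of_set (\<Union>s\<in>K. geometric_simplex s)"
proof -
  let ?P = "\<Union>s\<in>K. geometric_simplex s"
  have "openin (geometric_realization K) U \<longleftrightarrow> openin (top_of_set ?P) U" for U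
  proof
    assume U: "openin (geometric_realization K) U"
    have "closed (geometric_simplex s - U)" if "s \<in> K" for s
    proof -
      have "closedin (top_of_set (geometric_simplex s)) (geometric_simplex s - U \<inter> geometric_simplex s)"
        using U that by (intro closedin_diff) (auto simp: openin_geometric_realization)
      then have "closed (geometric_simplex s - U \<inter> geometric_simplex s)"
        by (rule closedin_closed_trans[OF _ closed_geometric_simplex])
      then show ?thesis
        by (simp add: Diff_Int2 Diff_Int)
    qed
    then have "closed (\<Union>s\<in>K. geometric_simplex s - U)"
      using assms by blast
    moreover have "U = ?P \<inter> - (\<Union>s\<in>K. geometric_simplex s - U)"
      using U by (auto simp: openin_geometric_realization)
    ultimately show "openin (top_of_set ?P) U"
      by (metis open_Compl openin_open)
  next
    assume "openin (top_of_set ?P) U"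
    then obtain W where "open W" and U: "U = ?P \<inter> W"
      by (auto simp: openin_open)
    have "U \<inter> geometric_simplex s = geometric_simplex s \<inter> W" if "s \<in> K" for s
      using that U by blast
    then show "openin (geometric_realization K) U"
      using U \<open>open W\<close> by (simp add: openin_geometric_realization openin_open_Int)
  qed
  then show ?thesis
    by (simp add: topology_eq)
qed

section \<open>Barycentric subdivision\<close>

lemma finite_chain_Union_in:
  assumes "finite C" "C \<noteq> {}" "chain_subset C"
  shows "\<Union>C \<in> C"
  using assms Union_in_chain[of C UNIV] by (simp add: chain_subset_alt_def)

text \<open>One step of a descending induction on cardinality. Once the larger simplexes cancel, a
  vertex of \<open>s\<close> lying in no other member of \<open>C\<close> of at most the size of
  \<open>s\<close> isolates \<open>w' s\<close> in the coordinate sum, and nonnegativity of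
  \<open>w\<close> keeps \<open>w s\<close> below that sum.\<close>

lemma chain_weight_le:
  fixes w w' :: "'v set \<Rightarrow> real"
  assumes K: "finite K" "\<And>t. t \<in> K \<Longrightarrow> finite t" and s: "s \<in> K" "s \<noteq> {}"
    and C: "C \<subseteq> K" "chain_subset C" and w': "\<And>t. t \<in> K - C \<Longrightarrow> w' t = 0"
    and nonneg: "\<And>t. t \<in> K \<Longrightarrow> 0 \<le> w t"
    and eq: "\<And>v. (\<Sum>t | t \<in> K \<and> v \<in> t. w t) = (\<Sum>t | t \<in> K \<and> v \<in> t. w' t)"
    and larger: "\<And>t. t \<in> K \<Longrightarrow> card s < card t \<Longrightarrow> w t = w' t"
  shows "w s \<le> w' s"
proof -
  let ?A = "{t \<in> C. card t \<le> card s \<and> t \<noteq> s}"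
  \<comment> \<open>At this vertex, \<open>s\<close> is the only simplex of \<open>C\<close> that is not larger than \<open>s\<close>.\<close>
  obtain v where v: "v \<in> s" "v \<notin> \<Union>?A"
  proof (cases "?A = {}")
    case True
    with s that show ?thesis by auto
  next
    case False
    have "finite ?A"
      using C(1) K(1) by (simp add: finite_subset)
    then have A: "\<Union>?A \<in> ?A"
    proof (rule finite_chain_Union_in[OF _ False])
      show "chain_subset ?A"
        using C(2) unfolding chain_subset_def by blast
    qed
    moreover have "finite (\<Union>?A)"
      using A K(2) C(1) by blast
    \<comment> \<open>Otherwise \<open>s\<close> is contained in a member of \<open>?A\<close> that
      is no larger, hence equal to it; but \<open>?A\<close> excludes \<open>s\<close>.\<close>
    ultimately have "\<not> s \<subseteq> \<Union>?A"
      using card_seteq[of "\<Union>?A" s] by fastforce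
    with that show ?thesis by blast
  qed
  let ?S = "{t \<in> K. v \<in> t \<and> card t \<le> card s}" and ?L = "{t \<in> K. v \<in> t \<and> card s < card t}"
  have split: "(\<Sum>t | t \<in> K \<and> v \<in> t. u t) = sum u ?S + sum u ?L" for u :: "'v set \<Rightarrow> real"
  proof -
    have "{t. t \<in> K \<and> v \<in> t} = ?S \<union> ?L" "?S \<inter> ?L = {}"
      by auto
    then show ?thesis
      using K(1) by (simp add: sum.union_disjoint)
  qed
  have "sum w ?L = sum w' ?L"
    using larger by (auto intro: sum.cong)
  then have "sum w ?S = sum w' ?S"
    using eq[of v] by (simp add: split)
  moreover have "w s \<le> sum w ?S"
    using s v K(1) nonneg by (intro member_le_sum) auto
  \<comment> \<open>By the choice of \<open>v\<close>, every other simplex in \<open>?S\<close> lies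
    outside \<open>C\<close>, where \<open>w'\<close> vanishes.\<close>
  moreover have "sum w' ?S = sum w' {s}"
    using s v K(1) w' by (intro sum.mono_neutral_right) auto
  ultimately show ?thesis by simp
qed

text \<open>At a largest simplex where the weights differ, \<open>chain_weight_le\<close> applies in
  both directions.\<close>

lemma chain_weight_unique:
  fixes w w' :: "'v set \<Rightarrow> real"
  assumes K: "finite K" "\<And>t. t \<in> K \<Longrightarrow> finite t \<and> t \<noteq> {}"
    and C: "C \<subseteq> K" "chain_subset C" "\<And>t. t \<in> K - C \<Longrightarrow> w t = 0" "\<And>t. t \<in> K \<Longrightarrow> 0 \<le> w t"
    and C': "C' \<subseteq> K" "chain_subset C'" "\<And>t. t \<in> K - C' \<Longrightarrow> w' t = 0" "\<And>t. t \<in> K \<Longrightarrow> 0 \<le> w' t"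
    and eq: "\<And>v. (\<Sum>t | t \<in> K \<and> v \<in> t. w t) = (\<Sum>t | t \<in> K \<and> v \<in> t. w' t)"
    and "s \<in> K"
  shows "w s = w' s"
proof (rule ccontr)
  define D where "D = {t \<in> K. w t \<noteq> w' t}"
  assume "w s \<noteq> w' s"
  then have D: "finite D" "D \<noteq> {}"
    using \<open>s \<in> K\<close> K by (auto simp: D_def)
  then have "Max (card ` D) \<in> card ` D"
    by (intro Max_in) auto
  then obtain t where t: "t \<in> D" "card t = Max (card ` D)"
    by (metis imageE)
  have larger: "w u = w' u" if "u \<in> K" "card t < card u" for u
  proof (rule ccontr)
    assume "w u \<noteq> w' u"
    then have "card u \<le> Max (card ` D)"
      using D that by (auto simp: D_def)
    with t that show False by simp
  qed
  have "t \<in> K" "t \<noteq> {}" using t K by (auto simp: D_def)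
  have "w t \<le> w' t"
    by (rule chain_weight_le[where K = K and C = C']) (use K C C' eq larger \<open>t \<in> K\<close> \<open>t \<noteq> {}\<close> in auto)
  moreover have "w' t \<le> w t"
    by (rule chain_weight_le[where K = K and C = C]) (use K C C' eq larger \<open>t \<in> K\<close> \<open>t \<noteq> {}\<close> in auto)
  ultimately show False
    using t by (simp add: D_def)
qed

text \<open>A layer-cake decomposition: subtracting the minimum of \<open>b\<close> on its support
  leaves a function with strictly smaller support, and the support itself tops the chain obtained by
  induction.\<close>

lemma chain_weight_exists:
  fixes b :: "'v \<Rightarrow> real"
  assumes "finite \<sigma>" "\<And>v. 0 \<le> b v" "\<And>v. b v \<noteq> 0 \<longleftrightarrow> v \<in> \<sigma>"
  shows "\<exists>C w. C \<subseteq> Pow \<sigma> - {{}} \<and> chain_subset C \<and> (\<forall>s. 0 \<le> w s) \<and>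
           (\<forall>v. b v = (\<Sum>s | s \<in> C \<and> v \<in> s. w s))"
  using assms
proof (induction \<sigma> arbitrary: b rule: finite_psubset_induct)
  case (psubset \<sigma>)
  show ?case
  proof (cases "\<sigma> = {}")
    case True
    then have "b v = 0" for v using psubset.prems by blast
    then show ?thesis
      by (intro exI[of _ "{}"] exI[of _ "\<lambda>_. 0"]) (auto simp: chain_subset_def)
  next
    case False
    define m where "m = Min (b ` \<sigma>)"
    define b' where "b' = (\<lambda>v. if v \<in> \<sigma> then b v - m else 0)"
    define \<tau> where "\<tau> = {v \<in> \<sigma>. b v \<noteq> m}"
    have m_le: "m \<le> b v" if "v \<in> \<sigma>" for v
      using that psubset.hyps by (simp add: m_def)
    have "m \<in> b ` \<sigma>"
      using False psubset.hyps by (simp add: m_def)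
    then have \<tau>: "\<tau> \<subset> \<sigma>" and "0 \<le> m"
      using psubset.prems(1) by (auto simp: \<tau>_def)
    have "\<exists>C w. C \<subseteq> Pow \<tau> - {{}} \<and> chain_subset C \<and> (\<forall>s. 0 \<le> w s) \<and>
            (\<forall>v. b' v = (\<Sum>s | s \<in> C \<and> v \<in> s. w s))"
      by (rule psubset.IH[OF \<tau>]) (use m_le in \<open>auto simp: b'_def \<tau>_def\<close>)
    then obtain C w where C: "C \<subseteq> Pow \<tau> - {{}}" "chain_subset C" and w: "\<And>s. 0 \<le> w s"
      and b': "\<And>v. b' v = (\<Sum>s | s \<in> C \<and> v \<in> s. w s)"
      by blast
    let ?w = "w(\<sigma> := m)"
    \<comment> \<open>Every member of \<open>C\<close> lies in the proper subset
      \<open>\<tau>\<close>, so setting the weight at \<open>\<sigma>\<close> to \<open>m\<close>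
      affects none of them.\<close>
    have "\<sigma> \<notin> C" using C \<tau> by blast
    have "finite C"
      by (rule finite_subset[of _ "Pow \<sigma>"]) (use C(1) \<tau> psubset.hyps in auto)
    have "b v = (\<Sum>s | s \<in> insert \<sigma> C \<and> v \<in> s. ?w s)" for v
    proof (cases "v \<in> \<sigma>")
      case True
      then have "{s. s \<in> insert \<sigma> C \<and> v \<in> s} = insert \<sigma> {s. s \<in> C \<and> v \<in> s}"
        by auto
      moreover have "(\<Sum>s | s \<in> C \<and> v \<in> s. ?w s) = b' v"
        unfolding b' using \<open>\<sigma> \<notin> C\<close> by (intro sum.cong) auto
      ultimately show ?thesis
        using True \<open>finite C\<close> \<open>\<sigma> \<notin> C\<close> by (simp add: b'_def)
    next
      case False
      then have "{s. s \<in> insert \<sigma> C \<and> v \<in> s} = {}"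
        using C \<tau> by blast
      moreover have "b v = 0"
        using False psubset.prems(2) by blast
      ultimately show ?thesis
        by (simp only: sum.empty)
    qed
    moreover have C_sub: "insert \<sigma> C \<subseteq> Pow \<sigma> - {{}}"
      using C \<tau> False by blast
    moreover have "chain_subset (insert \<sigma> C)"
      using C(2) C_sub unfolding chain_subset_def by blast
    moreover have "\<forall>s. 0 \<le> ?w s"
      using w \<open>0 \<le> m\<close> by simp
    ultimately show ?thesis
      by blast
  qed
qed

section \<open>Homeomorphism between the subdivision and the complex\<close>

definition barycentric_subdivision :: "'v set set \<Rightarrow> 'v set set set" where
  "barycentric_subdivision K = {C. C \<subseteq> K \<and> C \<noteq> {} \<and> chain_subset C}"

text \<open>The vertices of the subdivision are renamed by \<open>f\<close>; the homeomorphism sends the vertex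
  \<open>f s\<close> to the barycenter of \<open>s\<close> and is affine on every simplex of the subdivision.\<close>

lemma barycentric_subdivision_homeomorphic:
  fixes K :: "'v set set" and f :: "'v set \<Rightarrow> 'a"
  assumes K: "abstract_simplicial_complex K" "finite K" and f: "inj_on f K"
  shows "geometric_realization ((`) f ` barycentric_subdivision K)
           homeomorphic_space geometric_realization K"
proof -
  define L where "L = (`) f ` barycentric_subdivision K"
  \<comment> \<open>The barycenter of \<open>s\<close> has coordinate \<open>1 / card s\<close> at
    each vertex of \<open>s\<close>. Summing over all of \<open>K\<close> instead of one chain gives
    a single formula, from which continuity is immediate.\<close>
  define \<Phi> :: "('a \<Rightarrow> real) \<Rightarrow> 'v \<Rightarrow> real"
    where "\<Phi> a v = (\<Sum>s | s \<in> K \<and> v \<in> s. a (f s) / card s)" for a v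
  let ?P = "\<Union>S\<in>L. geometric_simplex S" and ?Q = "\<Union>s\<in>K. geometric_simplex s"
  have simplex: "finite s" "s \<noteq> {}" if "s \<in> K" for s
    using K(1) that unfolding abstract_simplicial_complex_def by blast+
  have face: "t \<in> K" if "s \<in> K" "t \<subseteq> s" "t \<noteq> {}" for s t
    using K(1) that unfolding abstract_simplicial_complex_def by blast+
  have card_pos: "card s > 0" if "s \<in> K" for s
    using simplex[OF that] by (simp add: card_gt_0_iff)
  have "finite (barycentric_subdivision K)"
    by (rule finite_subset[of _ "Pow K"]) (use K(2) in \<open>auto simp: barycentric_subdivision_def\<close>)
  then have "finite L" by (simp add: L_def)
  have finite_S: "finite S" if "S \<in> L" for S
    using that K(2) by (auto simp: L_def barycentric_subdivision_def intro: finite_subset)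
  have \<Phi>_chain: "\<Phi> a v = (\<Sum>s\<in>C. if v \<in> s then a (f s) / card s else 0)"
    if C: "C \<subseteq> K" and a: "a \<in> geometric_simplex (f ` C)" for a v C
  proof -
    have zero: "a (f s) = 0" if "s \<in> K - C" for s
      using a that C f by (auto simp: geometric_simplex_def inj_on_image_mem_iff)
    have "\<Phi> a v = (\<Sum>s\<in>K. if v \<in> s then a (f s) / card s else 0)"
      unfolding \<Phi>_def using K(2) by (simp add: sum.inter_filter)
    also have "\<dots> = (\<Sum>s\<in>C. if v \<in> s then a (f s) / card s else 0)"
      using K(2) C zero by (intro sum.mono_neutral_right) auto
    finally show ?thesis .
  qed
  have into: "\<Phi> a \<in> geometric_simplex (\<Union>C)"
    if C: "C \<in> barycentric_subdivision K" and a: "a \<in> geometric_simplex (f ` C)" for a C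
  proof -
    have C: "C \<subseteq> K" "C \<noteq> {}" "chain_subset C"
      using C by (auto simp: barycentric_subdivision_def)
    have "finite C" using C K(2) finite_subset by blast
    have "finite (\<Union>C)" using C simplex \<open>finite C\<close> by blast
    \<comment> \<open>Each \<open>s\<close> spreads its mass \<open>a (f s)\<close> evenly over its
      \<open>card s\<close> vertices, so the total mass is preserved.\<close>
    have "(\<Sum>v\<in>\<Union>C. \<Phi> a v) = (\<Sum>v\<in>\<Union>C. \<Sum>s\<in>C. if v \<in> s then a (f s) / card s else 0)"
      using \<Phi>_chain[OF C(1) a] by simp
    also have "\<dots> = (\<Sum>s\<in>C. \<Sum>v\<in>\<Union>C. if v \<in> s then a (f s) / card s else 0)"
      by (rule sum.swap)
    also have "\<dots> = (\<Sum>s\<in>C. a (f s))"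
    proof (rule sum.cong)
      fix s assume s: "s \<in> C"
      then have "{v \<in> \<Union>C. v \<in> s} = s" by blast
      then have "(\<Sum>v\<in>\<Union>C. if v \<in> s then a (f s) / card s else 0) = (\<Sum>v\<in>s. a (f s) / card s)"
        using \<open>finite (\<Union>C)\<close> by (simp only: sum.inter_filter[symmetric])
      then show "(\<Sum>v\<in>\<Union>C. if v \<in> s then a (f s) / card s else 0) = a (f s)"
        using card_pos[of s] s C by auto
    qed simp
    also have "\<dots> = sum a (f ` C)"
      using f C(1) by (simp add: sum.reindex inj_on_subset)
    also have "\<dots> = 1"
      using a by (simp add: geometric_simplex_def)
    finally have "(\<Sum>v\<in>\<Union>C. \<Phi> a v) = 1" .
    moreover have "0 \<le> \<Phi> a v" for v
      unfolding \<Phi>_def using a by (auto simp: geometric_simplex_def intro: sum_nonneg)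
    moreover have "\<Phi> a v = 0" if "v \<notin> \<Union>C" for v
      unfolding \<Phi>_chain[OF C(1) a] using that by (intro sum.neutral) auto
    ultimately show ?thesis
      by (simp add: geometric_simplex_def)
  qed
  have inj: "inj_on \<Phi> ?P"
  proof (rule inj_onI)
    fix a a' assume a: "a \<in> ?P" and a': "a' \<in> ?P" and eq: "\<Phi> a = \<Phi> a'"
    obtain C where C: "C \<subseteq> K" "chain_subset C" and aC: "a \<in> geometric_simplex (f ` C)"
      using a by (auto simp: L_def barycentric_subdivision_def)
    obtain C' where C': "C' \<subseteq> K" "chain_subset C'" and aC': "a' \<in> geometric_simplex (f ` C')"
      using a' by (auto simp: L_def barycentric_subdivision_def)
    have "a (f s) / card s = a' (f s) / card s" if "s \<in> K" for s
    proof (rule chain_weight_unique[where K = K and C = C and C' = C'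
          and w = "\<lambda>s. a (f s) / card s" and w' = "\<lambda>s. a' (f s) / card s"])
      show "(\<Sum>t | t \<in> K \<and> v \<in> t. a (f t) / card t) = (\<Sum>t | t \<in> K \<and> v \<in> t. a' (f t) / card t)" for v
        using fun_cong[OF eq, of v] by (simp add: \<Phi>_def)
    qed (use K(2) simplex C C' aC aC' f that in
          \<open>auto simp: geometric_simplex_def inj_on_image_mem_iff\<close>)
    then have on: "a (f s) = a' (f s)" if "s \<in> K" for s
      using card_pos[OF that] that by fastforce
    show "a = a'"
    proof
      fix x
      show "a x = a' x"
      proof (cases "x \<in> f ` K")
        case False
        then have "x \<notin> f ` C" "x \<notin> f ` C'" using C C' by blast+
        with aC aC' show ?thesis by (simp add: geometric_simplex_def)
      qed (use on in auto)
    qed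
  qed
  have surj: "b \<in> \<Phi> ` ?P" if b_in: "b \<in> ?Q" for b
  proof -
    obtain \<sigma> where \<sigma>: "\<sigma> \<in> K" and b: "b \<in> geometric_simplex \<sigma>"
      using b_in by blast
    \<comment> \<open>The chain is built inside the support of \<open>b\<close>, so its members are
      faces of \<open>\<sigma>\<close> and belong to \<open>K\<close>.\<close>
    define \<tau> where "\<tau> = {v. b v \<noteq> 0}"
    have \<tau>: "\<tau> \<subseteq> \<sigma>" and nonneg: "0 \<le> b v" for v
      using b by (auto simp: geometric_simplex_def \<tau>_def)
    have sum_b: "sum b \<sigma> = 1"
      using b by (simp add: geometric_simplex_def)
    have "finite \<tau>"
      using \<tau> \<sigma> simplex finite_subset by blast
    then have "\<exists>C w. C \<subseteq> Pow \<tau> - {{}} \<and> chain_subset C \<and> (\<forall>s. 0 \<le> w s) \<and>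
        (\<forall>v. b v = (\<Sum>s | s \<in> C \<and> v \<in> s. w s))"
      by (rule chain_weight_exists) (simp_all add: nonneg \<tau>_def)
    then obtain C w where C: "C \<subseteq> Pow \<tau> - {{}}" "chain_subset C" and w: "\<And>s. 0 \<le> w s"
      and bw: "\<And>v. b v = (\<Sum>s | s \<in> C \<and> v \<in> s. w s)"
      by blast
    have CK: "C \<subseteq> K"
      using C \<tau> \<sigma> face by blast
    have "finite C" using CK K(2) finite_subset by blast
    define g where "g = inv_into K f"
    \<comment> \<open>The factor \<open>card (g x)\<close> cancels the division in
      \<open>\<Phi>\<close>.\<close>
    define a where "a = (\<lambda>x. if x \<in> f ` C then card (g x) * w (g x) else 0)"
    have a_f: "a (f s) = (if s \<in> C then card s * w s else 0)" if "s \<in> K" for s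
      using that f CK by (auto simp: a_def g_def inj_on_image_mem_iff)
    have "C \<noteq> {}"
    proof
      assume "C = {}"
      then have "b v = 0" for v using bw by simp
      with sum_b show False by simp
    qed
    then have CL: "C \<in> barycentric_subdivision K"
      using CK C by (simp add: barycentric_subdivision_def)
    have "\<Phi> a = b"
    proof
      fix v
      have "\<Phi> a v = (\<Sum>s | s \<in> K \<and> v \<in> s. if s \<in> C then w s else 0)"
        unfolding \<Phi>_def using a_f card_pos by (intro sum.cong) auto
      also have "\<dots> = (\<Sum>s | s \<in> C \<and> v \<in> s. w s)"
        using K(2) CK by (intro sum.mono_neutral_cong_right) auto
      finally show "\<Phi> a v = b v" using bw by simp
    qed
    have "sum a (f ` C) = (\<Sum>s\<in>C. card s * w s)"
      using f CK a_f by (subst sum.reindex) (auto intro: inj_on_subset intro!: sum.cong)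
    \<comment> \<open>Counting the weight of \<open>s\<close> once per vertex and exchanging the
      sums turns the total mass of \<open>a\<close> into that of \<open>b\<close>, which is
      1.\<close>
    also have "\<dots> = (\<Sum>s\<in>C. \<Sum>v\<in>\<sigma>. if v \<in> s then w s else 0)"
    proof (rule sum.cong)
      fix s assume "s \<in> C"
      then have "{v \<in> \<sigma>. v \<in> s} = s" using C \<tau> by blast
      then show "card s * w s = (\<Sum>v\<in>\<sigma>. if v \<in> s then w s else 0)"
        using simplex(1)[OF \<sigma>] by (simp add: sum.inter_filter[symmetric])
    qed simp
    also have "\<dots> = (\<Sum>v\<in>\<sigma>. \<Sum>s\<in>C. if v \<in> s then w s else 0)"
      by (rule sum.swap)
    also have "\<dots> = sum b \<sigma>"
      using bw \<open>finite C\<close> by (simp add: sum.inter_filter)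
    finally have "sum a (f ` C) = 1" using sum_b by simp
    then have "a \<in> geometric_simplex (f ` C)"
      using w by (auto simp: geometric_simplex_def a_def)
    with CL \<open>\<Phi> a = b\<close> show ?thesis
      by (auto simp: L_def)
  qed
  have "\<Phi> ` ?P = ?Q"
  proof
    show "\<Phi> ` ?P \<subseteq> ?Q"
    proof
      fix b assume "b \<in> \<Phi> ` ?P"
      then obtain a C where C: "C \<in> barycentric_subdivision K"
        and "a \<in> geometric_simplex (f ` C)" "b = \<Phi> a"
        by (auto simp: L_def)
      then have "b \<in> geometric_simplex (\<Union>C)" using into by simp
      \<comment> \<open>The union of a finite nonempty chain is its largest member.\<close>
      moreover have "\<Union>C \<in> K"
        using C finite_chain_Union_in[of C] K(2) finite_subset
        by (auto simp: barycentric_subdivision_def)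
      ultimately show "b \<in> ?Q" by blast
    qed
    show "?Q \<subseteq> \<Phi> ` ?P" using surj by blast
  qed
  have cont: "continuous_on UNIV \<Phi>"
    unfolding \<Phi>_def by (intro continuous_intros) (auto dest: card_pos)
  have "homeomorphic_map (top_of_set ?P) (top_of_set ?Q) \<Phi>"
  proof (rule continuous_imp_homeomorphic_map)
    show "continuous_map (top_of_set ?P) (top_of_set ?Q) \<Phi>"
      using cont \<open>\<Phi> ` ?P = ?Q\<close> by (auto intro: continuous_on_subset)
    show "compact_space (top_of_set ?P)"
    proof -
      have "compact ?P"
        using \<open>finite L\<close> finite_S by (intro compact_UN ballI compact_geometric_simplex)
      then show ?thesis
        by (simp add: compact_space_subtopology)
    qed
    show "Hausdorff_space (top_of_set ?Q)"
      by (rule Hausdorff_space_subtopology[OF Hausdorff_space_euclidean_fun])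
  qed (use inj \<open>\<Phi> ` ?P = ?Q\<close> in simp_all)
  then have "homeomorphic_map (geometric_realization L) (geometric_realization K) \<Phi>"
    using \<open>finite L\<close> K(2) by (simp add: geometric_realization_finite)
  then show ?thesis
    unfolding L_def by (rule homeomorphic_map_imp_homeomorphic_space)
qed


section \<open>Strings\<close>

text \<open>Needed to replace simplexes by natural numbers as points: an ordering witnessing the
  string property can be mapped by \<open>f\<close> and back by its inverse.\<close>

lemma long_string_image:
  assumes f: "inj_on f X"
  shows "long_string (f ` X) (\<lambda>x y. d (inv_into X f x) (inv_into X f y)) S \<longleftrightarrow>
    (\<exists>C. S = f ` C \<and> long_string X d C)"
proof
  let ?g = "inv_into X f"
  assume "long_string (f ` X) (\<lambda>x y. d (?g x) (?g y)) S"
  then obtain xs where S: "S \<subseteq> f ` X" and xs: "distinct xs" "set xs = S" "length xs \<ge> 3"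
    and eq: "(\<Sum>i<length xs - 1. d (?g (xs ! i)) (?g (xs ! Suc i))) = d (?g (hd xs)) (?g (last xs))"
    by (auto simp: long_string_def)
  have "distinct (map ?g xs)"
    using xs S by (simp add: distinct_map inj_on_inv_into)
  moreover have "?g ` S \<subseteq> X"
    using S by (auto intro: inv_into_into)
  moreover have "(\<Sum>i<length (map ?g xs) - 1. d (map ?g xs ! i) (map ?g xs ! Suc i)) =
      d (hd (map ?g xs)) (last (map ?g xs))"
  proof -
    have "xs \<noteq> []" using xs(3) by auto
    then show ?thesis using eq by (simp add: hd_map last_map)
  qed
  ultimately have "long_string X d (?g ` S)"
    unfolding long_string_def using xs by (intro conjI exI[of _ "map ?g xs"]) auto
  moreover have "S = f ` ?g ` S"
    using S by (simp add: image_inv_into_cancel)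
  ultimately show "\<exists>C. S = f ` C \<and> long_string X d C"
    by blast
next
  let ?g = "inv_into X f"
  assume "\<exists>C. S = f ` C \<and> long_string X d C"
  then obtain C xs where S: "S = f ` C" "C \<subseteq> X" and xs: "distinct xs" "set xs = C" "length xs \<ge> 3"
    and eq: "(\<Sum>i<length xs - 1. d (xs ! i) (xs ! Suc i)) = d (hd xs) (last xs)"
    by (auto simp: long_string_def)
  have "xs \<noteq> []" using xs(3) by auto
  have g: "?g (f x) = x" if "x \<in> set xs" for x
    using that xs S f by (auto intro: inv_into_f_f)
  have "distinct (map f xs)"
    using xs S f by (auto simp: distinct_map intro: inj_on_subset)
  moreover have "(\<Sum>i<length (map f xs) - 1. d (?g (map f xs ! i)) (?g (map f xs ! Suc i))) =
      d (?g (hd (map f xs))) (?g (last (map f xs)))"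
  proof -
    have "(\<Sum>i<length (map f xs) - 1. d (?g (map f xs ! i)) (?g (map f xs ! Suc i))) =
        (\<Sum>i<length xs - 1. d (xs ! i) (xs ! Suc i))"
      by (intro sum.cong) (auto simp: g)
    with eq \<open>xs \<noteq> []\<close> show ?thesis by (simp add: hd_map last_map g)
  qed
  ultimately show "long_string (f ` X) (\<lambda>x y. d (?g x) (?g y)) S"
    unfolding long_string_def using xs S by (intro conjI exI[of _ "map f xs"]) auto
qed

text \<open>The cases of length 1 and 2 follow from the long one, because \<open>f\<close> preserves
  the cardinality of subsets of \<open>X\<close> and every subset of an image is an image of a
  subset.\<close>

lemma is_string_image:
  assumes f: "inj_on f X"
  shows "is_string (f ` X) (\<lambda>x y. d (inv_into X f x) (inv_into X f y)) S \<longleftrightarrow>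
    (\<exists>C. S = f ` C \<and> is_string X d C)"
    (is "is_string _ ?d S \<longleftrightarrow> _")
proof -
  have sub: "C \<subseteq> X" if "long_string X d C" for C
    using that by (simp add: long_string_def)
  have card: "card (f ` C) = card C" if "C \<subseteq> X" for C
    using that f by (intro card_image) (rule inj_on_subset)
  define face where "face C \<longleftrightarrow> (\<exists>R. long_string X d R \<and> card R = 3 \<and> C \<subseteq> R)" for C
  define face' where "face' \<longleftrightarrow> (\<exists>R. long_string (f ` X) ?d R \<and> card R = 3 \<and> S \<subseteq> R)"
  have face'_iff: "face' \<longleftrightarrow> (\<exists>C. S = f ` C \<and> face C)"
    unfolding face_def face'_def
  proof
    assume "\<exists>R. long_string (f ` X) ?d R \<and> card R = 3 \<and> S \<subseteq> R"
    then obtain R where "long_string X d R" "card (f ` R) = 3" "S \<subseteq> f ` R"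
      unfolding long_string_image[OF f] by blast
    moreover from \<open>S \<subseteq> f ` R\<close> obtain C where "C \<subseteq> R" "S = f ` C"
      by (auto simp: subset_image_iff)
    ultimately show "\<exists>C. S = f ` C \<and> (\<exists>R. long_string X d R \<and> card R = 3 \<and> C \<subseteq> R)"
      using card sub by metis
  next
    assume "\<exists>C. S = f ` C \<and> (\<exists>R. long_string X d R \<and> card R = 3 \<and> C \<subseteq> R)"
    then obtain C R where "S = f ` C" "long_string X d R" "card R = 3" "C \<subseteq> R"
      by blast
    then show "\<exists>R. long_string (f ` X) ?d R \<and> card R = 3 \<and> S \<subseteq> R"
      unfolding long_string_image[OF f] using card sub by (intro exI[of _ "f ` R"]) auto
  qed
  have "card (f ` C) = card C" if "face C" for C
    using card sub that unfolding face_def by blast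
  then have "card S = n \<and> face' \<longleftrightarrow> (\<exists>C. S = f ` C \<and> card C = n \<and> face C)" for n
    unfolding face'_iff by metis
  then show ?thesis
    unfolding is_string_def face_def[symmetric] face'_def[symmetric]
    unfolding long_string_image[OF f]
    by blast
qed

text \<open>All distances between distinct simplexes lie in \<open>[1, 2]\<close>, which makes the triangle inequality
  automatic. Distinct comparable simplexes of a 2-dimensional complex have cardinalities with sum 4
  exactly if they are a vertex and a triangle.\<close>

definition flag_dist :: "'v set \<Rightarrow> 'v set \<Rightarrow> real" where
  "flag_dist s t = (if s = t then 0
     else if s \<subseteq> t \<or> t \<subseteq> s then (if card s + card t = 4 then 2 else 1) else 3 / 2)"

lemma flag_dist_commute: "flag_dist s t = flag_dist t s"
  by (auto simp: flag_dist_def add.commute)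

lemma flag_dist_nonneg: "0 \<le> flag_dist s t"
  by (simp add: flag_dist_def)

lemma flag_dist_eq_0: "flag_dist s t = 0 \<longleftrightarrow> s = t"
  by (simp add: flag_dist_def)

lemma flag_dist_ge_1: "s \<noteq> t \<Longrightarrow> 1 \<le> flag_dist s t"
  by (simp add: flag_dist_def)

lemma flag_dist_le_2: "flag_dist s t \<le> 2"
  by (simp add: flag_dist_def)

lemma flag_dist_triangle: "flag_dist r t \<le> flag_dist r s + flag_dist s t"
proof (cases "r = s \<or> s = t")
  case True
  then show ?thesis by (auto simp: flag_dist_def)
next
  case False
  then show ?thesis
    using flag_dist_ge_1[of r s] flag_dist_ge_1[of s t] flag_dist_le_2[of r t] by linarith
qed

lemma Metric_space_image_flag_dist:
  assumes "inj_on f K"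
  shows "Metric_space (f ` K) (\<lambda>x y. flag_dist (inv_into K f x) (inv_into K f y))"
proof
  fix x y assume "x \<in> f ` K" "y \<in> f ` K"
  then show "flag_dist (inv_into K f x) (inv_into K f y) = 0 \<longleftrightarrow> x = y"
    by (metis flag_dist_eq_0 f_inv_into_f)
qed (auto intro: flag_dist_nonneg flag_dist_commute flag_dist_triangle)

section \<open>Strings of the flag metric\<close>

lemma long_string_flag_dist:
  assumes K: "\<And>s. s \<in> K \<Longrightarrow> finite s \<and> s \<noteq> {} \<and> card s \<le> 3"
  shows "long_string K flag_dist C \<longleftrightarrow>
    (\<exists>r\<in>K. \<exists>s\<in>K. \<exists>t\<in>K. r \<subset> s \<and> s \<subset> t \<and> C = {r, s, t})"
proof
  have psub: "card s < card t" if "s \<subset> t" "t \<in> K" for s t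
    using that K by (simp add: psubset_card_mono)
  have pos: "0 < card s" if "s \<in> K" for s
    using K[OF that] by (simp add: card_gt_0_iff)
  \<comment> \<open>Distance 2 makes \<open>x\<close> a vertex and \<open>z\<close> a triangle. A
    nonempty simplex cannot lie properly in a vertex, nor one with at most 3 elements properly
    contain a triangle, so \<open>y\<close>, being comparable to both, lies between them.\<close>
  have flag: "x \<subset> y \<and> y \<subset> z" if "x \<subset> z" "x \<in> K" "y \<in> K" "z \<in> K" "x \<noteq> y" "y \<noteq> z"
      "flag_dist x z = 2" "flag_dist x y = 1" "flag_dist y z = 1" for x y z
  proof -
    have "card x + card z = 4" "x \<subseteq> y \<or> y \<subseteq> x" "y \<subseteq> z \<or> z \<subseteq> y"
      using that by (auto simp: flag_dist_def split: if_splits)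
    moreover have "card x < card z" "card z \<le> 3"
      using that psub K by auto
    ultimately have "card x = 1" "card z = 3"
      using pos[of x] that by linarith+
    have "\<not> y \<subset> x"
      using psub[of y x] pos[of y] that \<open>card x = 1\<close> by auto
    moreover have "\<not> z \<subset> y"
      using psub[of z y] K[of y] that \<open>card z = 3\<close> by auto
    ultimately show ?thesis
      using that \<open>x \<subseteq> y \<or> y \<subseteq> x\<close> \<open>y \<subseteq> z \<or> z \<subseteq> y\<close> by blast
  qed
  assume "long_string K flag_dist C"
  then obtain xs where C: "C \<subseteq> K" and xs: "distinct xs" "set xs = C" "length xs \<ge> 3"
    and eq: "(\<Sum>i<length xs - 1. flag_dist (xs ! i) (xs ! Suc i)) = flag_dist (hd xs) (last xs)"
    by (auto simp: long_string_def)
  \<comment> \<open>Each of the \<open>length xs - 1\<close> steps contributes at least 1, but the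
    total is a distance and so at most 2.\<close>
  have "of_nat (card {..<length xs - 1}) * 1 \<le>
      (\<Sum>i<length xs - 1. flag_dist (xs ! i) (xs ! Suc i))"
    using xs by (intro sum_bounded_below flag_dist_ge_1) (auto simp: nth_eq_iff_index_eq)
  then have "real (length xs - 1) \<le> 2"
    using eq flag_dist_le_2[of "hd xs" "last xs"] by simp
  then have "length xs = 3"
    using xs(3) by linarith
  then obtain x y z where xyz: "xs = [x, y, z]"
    by (auto simp: numeral_3_eq_3 length_Suc_conv)
  have inK: "x \<in> K" "y \<in> K" "z \<in> K" and neq: "x \<noteq> y" "y \<noteq> z" "x \<noteq> z"
    using C xs xyz by auto
  have "flag_dist x y + flag_dist y z = flag_dist x z"
    using eq by (simp add: xyz numeral_2_eq_2)
  then have d: "flag_dist x y = 1" "flag_dist y z = 1" "flag_dist x z = 2"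
    using flag_dist_ge_1[OF neq(1)] flag_dist_ge_1[OF neq(2)] flag_dist_le_2[of x z] by linarith+
  have Ceq: "C = {x, y, z}" using xs xyz by auto
  from d(3) neq(3) have "x \<subset> z \<or> z \<subset> x"
    by (auto simp: flag_dist_def split: if_splits)
  then show "\<exists>r\<in>K. \<exists>s\<in>K. \<exists>t\<in>K. r \<subset> s \<and> s \<subset> t \<and> C = {r, s, t}"
  proof
    assume "x \<subset> z"
    then have "x \<subset> y \<and> y \<subset> z"
      by (rule flag) (use inK neq d in auto)
    then show ?thesis using Ceq inK by blast
  next
    assume "z \<subset> x"
    then have "z \<subset> y \<and> y \<subset> x"
      by (rule flag) (use inK neq d in \<open>auto simp: flag_dist_commute\<close>)
    moreover have "C = {z, y, x}" using Ceq by auto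
    ultimately show ?thesis using inK by blast
  qed
next
  assume "\<exists>r\<in>K. \<exists>s\<in>K. \<exists>t\<in>K. r \<subset> s \<and> s \<subset> t \<and> C = {r, s, t}"
  then obtain r s t where rst: "r \<in> K" "s \<in> K" "t \<in> K" "r \<subset> s" "s \<subset> t" and C: "C = {r, s, t}"
    by blast
  have "card r < card s" "card s < card t" "0 < card r" "card t \<le> 3"
    using rst K by (auto simp: psubset_card_mono card_gt_0_iff)
  then have "card r = 1" "card s = 2" "card t = 3"
    by linarith+
  \<comment> \<open>Only the pair of sizes 1 and 3 has sum 4; the other two pairs have sums 3 and
    5.\<close>
  then have "flag_dist r s = 1" "flag_dist s t = 1" "flag_dist r t = 2"
    using rst by (auto simp: flag_dist_def)
  then show "long_string K flag_dist C"
    unfolding long_string_def using rst C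
    by (intro conjI exI[of _ "[r, s, t]"]) (auto simp: numeral_2_eq_2)
qed

text \<open>Every string is a nonempty part of a full flag. Conversely, purity completes each
  nonempty chain to a full flag, and its cardinality decides which clause of the string definition
  applies.\<close>

lemma is_string_flag_dist:
  assumes K: "abstract_simplicial_complex K" and pure: "\<And>s. s \<in> K \<Longrightarrow> \<exists>t\<in>K. s \<subseteq> t \<and> card t = 3"
  shows "is_string K flag_dist C \<longleftrightarrow> C \<in> barycentric_subdivision K"
proof -
  have face: "t \<in> K" if "s \<in> K" "t \<subseteq> s" "t \<noteq> {}" for s t
    using K that unfolding abstract_simplicial_complex_def by blast
  have simplex: "finite s \<and> s \<noteq> {} \<and> card s \<le> 3" if s: "s \<in> K" for s
  proof -
    obtain t where "t \<in> K" "s \<subseteq> t" "card t = 3"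
      using pure[OF s] by blast
    \<comment> \<open>\<open>card t = 3\<close> forces \<open>t\<close> to be finite, since infinite
      sets have \<open>card\<close> 0.\<close>
    then have "card s \<le> 3" using card_mono[of t s] card.infinite[of t] by fastforce
    then show ?thesis using K s by (auto simp: abstract_simplicial_complex_def)
  qed
  have long: "long_string K flag_dist R \<longleftrightarrow>
      (\<exists>r\<in>K. \<exists>s\<in>K. \<exists>t\<in>K. r \<subset> s \<and> s \<subset> t \<and> R = {r, s, t})" for R
    using simplex by (rule long_string_flag_dist)
  have card_long: "card R = 3" if R: "long_string K flag_dist R" for R
  proof -
    obtain r s t where "r \<subset> s" "s \<subset> t" "R = {r, s, t}"
      using R unfolding long by blast
    moreover from this have "r \<noteq> s" "s \<noteq> t" "r \<noteq> t"
      by auto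
    ultimately show ?thesis
      by simp
  qed
  have extend: "\<exists>R. long_string K flag_dist R \<and> C \<subseteq> R" if C: "C \<in> barycentric_subdivision K"
  proof -
    have C: "C \<subseteq> K" "C \<noteq> {}" "chain_subset C"
      using C by (auto simp: barycentric_subdivision_def)
    have same_card: "s = t" if "s \<in> C" "t \<in> C" "card s = card t" for s t
      using that C simplex unfolding chain_subset_def by (metis card_subset_eq subsetD)
    \<comment> \<open>Members of a chain are told apart by their cardinalities, which are at most 3,
      so the chain is finite.\<close>
    have "inj_on card C" "card ` C \<subseteq> {..3}"
      using same_card C simplex by (auto intro!: inj_onI)
    then have "finite C"
      by (meson finite_atMost finite_imageD finite_subset)
    then have "\<Union>C \<in> C"
      using C by (intro finite_chain_Union_in) auto
    then obtain t where t: "t \<in> K" "card t = 3" "\<And>s. s \<in> C \<Longrightarrow> s \<subseteq> t"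
      using pure C by (meson Sup_le_iff subsetD)
    have "finite t" using t simplex by blast
    \<comment> \<open>A vertex of the smallest member lies in every member; it becomes the bottom of
      the flag, below the triangle \<open>t\<close>.\<close>
    obtain m where m: "m \<in> C" "\<And>s. s \<in> C \<Longrightarrow> card m \<le> card s"
      using C(2) ex_has_least_nat[of "\<lambda>s. s \<in> C" _ card] by blast
    have m_sub: "m \<subseteq> s" if "s \<in> C" for s
      using C m that simplex unfolding chain_subset_def by (metis card_seteq subsetD)
    obtain v where "v \<in> m" using m C simplex by blast
    then have v: "v \<in> s" if "s \<in> C" for s
      using m_sub that by blast
    have "v \<in> t" using v m t by blast
    \<comment> \<open>The middle of the flag is the edge in \<open>C\<close> if there is one, and
      otherwise any edge of \<open>t\<close> through \<open>v\<close>.\<close>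
    obtain e where e: "e \<subseteq> t" "card e = 2" "v \<in> e" and eC: "\<And>s. s \<in> C \<Longrightarrow> card s = 2 \<Longrightarrow> s = e"
    proof (cases "\<exists>s\<in>C. card s = 2")
      case True
      then show ?thesis using that t v same_card by metis
    next
      case False
      have "\<not> t \<subseteq> {v}"
        using t card_mono[of "{v}" t] by auto
      then obtain u where "u \<in> t" "u \<noteq> v" by blast
      with False \<open>v \<in> t\<close> show ?thesis
        by (intro that[of "{v, u}"]) auto
    qed
    have "{v} \<noteq> e" "e \<noteq> t" using e t by auto
    then have flag: "{v} \<subset> e" "e \<subset> t" using e by auto
    have "s \<in> {{v}, e, t}" if s: "s \<in> C" for s
    proof -
      have "card s \<noteq> 0" "card s \<le> 3" using s C simplex by auto
      then consider "card s = 1" | "card s = 2" | "card s = 3" by linarith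
      then show ?thesis
      proof cases
        case 1
        then show ?thesis using v[OF s] by (auto simp: card_1_singleton_iff)
      next
        case 2
        then show ?thesis using eC s by simp
      next
        case 3
        then show ?thesis using t s card_subset_eq[OF \<open>finite t\<close>] by simp
      qed
    qed
    moreover have "{v} \<in> K" "e \<in> K"
      using face[OF t(1)] e \<open>v \<in> t\<close> by auto
    ultimately show ?thesis
      using flag t(1) unfolding long by (intro exI[of _ "{{v}, e, t}"]) blast
  qed
  have sub: "C \<in> barycentric_subdivision K" if "long_string K flag_dist R" "C \<subseteq> R" "C \<noteq> {}" for R
    using that unfolding long barycentric_subdivision_def chain_subset_def by blast
  show ?thesis
  proof
    assume "is_string K flag_dist C"
    \<comment> \<open>\<open>sub\<close> asks for a nonempty set; each clause supplies a nonzero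
      cardinality, 3, 2 or 1.\<close>
    then show "C \<in> barycentric_subdivision K"
      unfolding is_string_def using sub card_long by (metis card.empty order_refl zero_neq_numeral zero_neq_one)
  next
    assume C: "C \<in> barycentric_subdivision K"
    then obtain R where R: "long_string K flag_dist R" "C \<subseteq> R" using extend by blast
    have "finite R" using card_long[OF R(1)] by (auto intro: card_ge_0_finite)
    have "C \<noteq> {}" using C by (simp add: barycentric_subdivision_def)
    then have "card C \<noteq> 0" "card C \<le> 3"
      using R card_long[OF R(1)] card_mono[OF \<open>finite R\<close> R(2)] finite_subset[OF R(2) \<open>finite R\<close>]
      by auto
    then consider "card C = 3" | "card C = 2" | "card C = 1" by linarith
    then show "is_string K flag_dist C"
    proof cases
      case 1
      then have "C = R"
        using R card_long[OF R(1)] \<open>finite R\<close> by (simp add: card_subset_eq)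
      with R show ?thesis by (simp add: is_string_def)
    qed (use R card_long in \<open>auto simp: is_string_def\<close>)
  qed
qed

section \<open>From a pure triangulation to a finite metric space\<close>

theorem theorem4p1:
  fixes T :: "'t topology" and K :: "'v set set" and h :: "'t \<Rightarrow> 'v \<Rightarrow> real"
  assumes "is_triangulation T K h"
    and "finite K"
    and "complex_dimension K 2"
    and "\<forall>v\<in>simplexes 0 K. \<exists>s\<in>simplexes 2 K. v \<subseteq> s"
    and "\<forall>e\<in>simplexes 1 K. \<exists>s\<in>simplexes 2 K. e \<subseteq> s"
  shows "\<exists>(X :: nat set) (d :: nat \<Rightarrow> nat \<Rightarrow> real).
           finite X \<and> Metric_space X d \<and> string_space X d homeomorphic_space T"
proof -
  have K: "abstract_simplicial_complex K"
    and h: "homeomorphic_map T (geometric_realization K) h"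
    using assms(1) by (auto simp: is_triangulation_def)
  \<comment> \<open>An \<open>n\<close>-simplex has \<open>n + 1\<close> elements: the two covering
    hypotheses handle cardinalities 1 and 2, and a simplex of cardinality 3 contains itself.\<close>
  have pure: "\<exists>t\<in>K. s \<subseteq> t \<and> card t = 3" if s: "s \<in> K" for s
  proof -
    have "finite s" "s \<noteq> {}"
      using s K unfolding abstract_simplicial_complex_def by blast+
    then have "card s \<noteq> 0"
      by simp
    moreover have "card s \<le> 3"
      using s assms(3) by (simp add: complex_dimension_def)
    ultimately consider "card s = 1" | "card s = 2" | "card s = 3" by linarith
    then show ?thesis
    proof cases
      case 1
      then have "s \<in> simplexes 0 K"
        using s by (simp add: simplexes_def)
      then obtain t where "t \<in> simplexes 2 K" "s \<subseteq> t"
        using assms(4) by blast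
      then show ?thesis
        by (auto simp: simplexes_def)
    next
      case 2
      then have "s \<in> simplexes 1 K"
        using s by (simp add: simplexes_def)
      then obtain t where "t \<in> simplexes 2 K" "s \<subseteq> t"
        using assms(5) by blast
      then show ?thesis
        by (auto simp: simplexes_def)
    next
      case 3
      with s show ?thesis by blast
    qed
  qed
  obtain f :: "'v set \<Rightarrow> nat" where f: "inj_on f K"
    using finite_imp_inj_to_nat_seg[OF assms(2)] by blast
  let ?d = "\<lambda>x y. flag_dist (inv_into K f x) (inv_into K f y)"
  \<comment> \<open>The strings are exactly the chains of simplexes, renamed by
    \<open>f\<close>.\<close>
  have "{S. is_string (f ` K) ?d S} = (`) f ` barycentric_subdivision K"
    using is_string_flag_dist[OF K pure] by (auto simp: is_string_image[OF f])
  then have "string_space (f ` K) ?d homeomorphic_space geometric_realization K"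
    unfolding string_space_def
    using barycentric_subdivision_homeomorphic[OF K assms(2) f] by simp
  also have "\<dots> homeomorphic_space T"
    using h homeomorphic_map_imp_homeomorphic_space homeomorphic_space_sym by blast
  finally have "string_space (f ` K) ?d homeomorphic_space T" .
  then show ?thesis
    using Metric_space_image_flag_dist[OF f] assms(2) by blast
qed

end
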